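(* Let $F$ and $G$ be locally convex Souslin topological vector spaces with Borel $\sigma$-algebras $\mathcal F$ and $\mathcal G$. On a complete probability space $(\Omega,\Sigma,P)$ let $X$ be an $F$-valued random variable and $\varepsilon$ a $G$-valued random variable statistically independent from $X$. Let $L:F\to G$ be continuous. Let $\mu_{\varepsilon+L(x)}$ be absolutely continuous with respect to a $\sigma$-finite measure $\nu$ on $(G,\mathcal G)$ for $\mu_X$-almost every $x\in F$. If $$\rho(x,z)=\begin{cases}\dfrac{d\mu_{\varepsilon+L(x)}}{d\nu}(z) & \text{when } \mu_{\varepsilon+L(x)}\ll\nu,\\ 0 & \text{otherwise,}\end{cases}$$ is a separately continuous function on some $F_0\times A$, where $F_0$ is a Souslin subset of $F$ with full $\mu_X$-measure and $A$ is a Souslin subset of $G$ such that $\nu(G\setminus A)=0$, then $\rho$ is $\mu_X\times\nu$-measurable. If additionally $\sup_{z\in K}\rho(x,z)\in L^1(\mu_X)$ (as a function of $x$) for all compact sets $K\subset G$, then $$z\mapsto\mu(U,z)=\frac{\int 1_U(x)\rho(x,z)\,d\mu_X(x)}{\int\rho(x,z)\,d\mu_X(x)}$$ is $\mathcal F$-continuous on $K\cap\{z\in A:0<\int\rho(x,z)\,d\mu_X(x)<\infty\}$ for every compact set $K\subset G$.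
   Context: A Souslin space is a Hausdorff topological space that is the image of a complete separable metric space under a continuous mapping; a Souslin subset is a subset that is a Souslin space in the relative topology. For a random variable $Z$, $\mu_Z=P\circ Z^{-1}$ is its image measure; for $x\in F$, $\mu_{\varepsilon+L(x)}$ is the image measure of $\omega\mapsto\varepsilon(\omega)+L(x)$. A Borel measure and its Lebesgue completion are denoted by the same symbol; "$\mu_X\times\nu$-measurable" means measurable with respect to the completion of the product $\sigma$-algebra under $\mu_X\times\nu$. A map $\mu(U,z)$ is $\mathcal F$-continuous on a set $B\subset G$ if $z\mapsto\mu(U,z)$ is continuous on $B$ with respect to the relative topology for every $U\in\mathcal F$. *)

theory Defs
  imports "HOL-Probability.Probability"
begin

class topological_real_vector = real_vector + topological_ab_group_add +
  assumes tendsto_scaleR_Pair: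
    "LIM p (nhds r \<times>\<^sub>F nhds a). fst p *\<^sub>R snd p :> nhds (r *\<^sub>R a)"

text \<open>A class axiom cannot mention \<^const>\<open>convex\<close>, whose type is sort-constrained, so the
  definition of convexity is unfolded; \<open>ex_open_convex_subset\<close> folds it back.\<close>

class locally_convex_space = topological_real_vector +
  assumes locally_convex:
    "open U \<Longrightarrow> 0 \<in> U \<Longrightarrow>
       \<exists>V. open V \<and> (\<forall>x\<in>V. \<forall>y\<in>V. \<forall>u\<ge>0. \<forall>v\<ge>0. u + v = 1 \<longrightarrow> u *\<^sub>R x + v *\<^sub>R y \<in> V) \<and>
           0 \<in> V \<and> V \<subseteq> U"

lemma ex_open_convex_subset:
  fixes U :: "'a::locally_convex_space set"
  assumes "open U" "0 \<in> U"
  shows "\<exists>V. open V \<and> convex V \<and> 0 \<in> V \<and> V \<subseteq> U"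
  using locally_convex[OF assms] unfolding convex_def by blast

text \<open>
  The complete separable metric space is carried by a set of reals, because one cannot quantify
  over types inside a definition.  Nothing is lost: a separable metric space has at most the
  cardinality of the continuum, so its metric can be transported to a set of reals; see
  \<open>Souslin_spaceI\<close> below.
\<close>

definition Souslin_space :: "'a topology \<Rightarrow> bool" where
  "Souslin_space T \<longleftrightarrow> Hausdorff_space T \<and>
     (\<exists>(M :: real set) d f. Metric_space M d \<and> Metric_space.mcomplete M d \<and>
        separable_space (Metric_space.mtopology M d) \<and>
        continuous_map (Metric_space.mtopology M d) T f \<and> f ` M = topspace T)"

lemma Souslin_spaceI:
  fixes M :: "'m set" and d :: "'m \<Rightarrow> 'm \<Rightarrow> real" and f :: "'m \<Rightarrow> 'a"
  assumes T: "Hausdorff_space T"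
    and M: "Metric_space M d" "Metric_space.mcomplete M d"
           "separable_space (Metric_space.mtopology M d)"
    and f: "continuous_map (Metric_space.mtopology M d) T f" "f ` M = topspace T"
  shows "Souslin_space T"
proof -
  interpret M: Metric_space M d by (fact M(1))
  obtain C where C: "countable C" "C \<subseteq> M" "M.mtopology closure_of C = M"
    using M(3) unfolding separable_space_def by auto
  define h where "h x = {(n, m). d (from_nat_into C n) x < 1 / real (Suc m)}" for x
  have "inj_on h M"
  proof (rule inj_onI, rule ccontr)
    fix x y assume xy: "x \<in> M" "y \<in> M" "h x = h y" "x \<noteq> y"
    then have pos: "0 < d x y / 2" by simp
    obtain m where m: "1 / real (Suc m) < d x y / 2"
      using nat_approx_posE[OF pos] by blast
    have "x \<in> M.mtopology closure_of C" using C xy by simp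
    then obtain c where c: "c \<in> C" "d x c < 1 / real (Suc m)"
      unfolding M.metric_closure_of by (auto dest: spec[of _ "1 / real (Suc m)"])
    obtain n where n: "from_nat_into C n = c"
      using from_nat_into_surj[OF C(1) c(1)] by blast
    have "(n, m) \<in> h x" using c n by (simp add: h_def M.commute)
    then have "(n, m) \<in> h y" using xy by simp
    then have "d c y < 1 / real (Suc m)" using n by (simp add: h_def)
    moreover have "d x y \<le> d x c + d c y" using M.triangle xy c C by blast
    ultimately show False using c m by linarith
  qed
  moreover obtain e :: "nat set \<Rightarrow> real" where e: "inj e"
    using eqpoll_imp_lepoll[OF nat_sets_eqpoll_reals] unfolding lepoll_def by blast
  ultimately have inj: "inj_on (\<lambda>x. e (prod_encode ` h x)) M"
    by (simp add: inj_on_def inj_eq[OF e] inj_image_eq_iff[OF inj_prod_encode])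
  define g where "g x = e (prod_encode ` h x)" for x
  have inj: "inj_on g M" using inj unfolding g_def .
  define k where "k = inv_into M g"
  define d' where "d' u v = d (k u) (k v)" for u v
  define N where "N = g ` M"
  have kg: "k (g x) = x" if "x \<in> M" for x
    using inj that by (simp add: k_def)
  have kN: "k ` N = M" using kg by (force simp: N_def)
  have gk: "g (k u) = u" if "u \<in> N" for u using that kg by (auto simp: N_def)
  interpret N: Metric_space N d'
  proof
    fix u v w assume uvw: "u \<in> N" "v \<in> N"
    then have "k u \<in> M" "k v \<in> M" using kN by auto
    then show "d' u v = 0 \<longleftrightarrow> u = v" using gk uvw unfolding d'_def by (metis M.zero)
    assume "w \<in> N"
    then have "k w \<in> M" using kN by auto
    then show "d' u w \<le> d' u v + d' v w"
      unfolding d'_def using M.triangle \<open>k u \<in> M\<close> \<open>k v \<in> M\<close> by blast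
  qed (auto simp: d'_def M.commute)
  interpret MN: Metric_space12 M d N d' ..
  interpret NM: Metric_space12 N d' M d ..
  have hg: "homeomorphic_map M.mtopology N.mtopology g"
    by (rule MN.isometry_imp_homeomorphic_map) (auto simp: N_def d'_def kg)
  have hk: "homeomorphic_map N.mtopology M.mtopology k"
    by (rule NM.isometry_imp_homeomorphic_map) (auto simp: kN d'_def)
  have "N.mcomplete"
    unfolding N.mcomplete_def
  proof (intro allI impI)
    fix s assume s: "N.MCauchy s"
    then have "M.MCauchy (k \<circ> s)"
      using kN unfolding N.MCauchy_def M.MCauchy_def by (auto simp: d'_def)
    then obtain x where "limitin M.mtopology (k \<circ> s) x sequentially"
      using M(2) unfolding M.mcomplete_def by auto
    then have "limitin N.mtopology (g \<circ> (k \<circ> s)) (g x) sequentially"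
      by (rule continuous_map_limit[OF homeomorphic_imp_continuous_map[OF hg]])
    moreover have "g \<circ> (k \<circ> s) = s"
      using s gk unfolding N.MCauchy_def by (auto simp: fun_eq_iff)
    ultimately show "\<exists>x. limitin N.mtopology s x sequentially" by auto
  qed
  moreover have "separable_space N.mtopology"
    using separable_space_continuous_map_image[OF M(3) homeomorphic_imp_continuous_map[OF hg]]
      homeomorphic_imp_surjective_map[OF hg] by simp
  moreover have "continuous_map N.mtopology T (f \<circ> k)"
    using continuous_map_compose[OF homeomorphic_imp_continuous_map[OF hk] f(1)] .
  moreover have "(f \<circ> k) ` N = topspace T" using kN f(2) by (metis image_comp)
  ultimately show ?thesis
    unfolding Souslin_space_def using T N.Metric_space_axioms by blast
qed

definition Souslin_subset :: "'a::topological_space set \<Rightarrow> bool" where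
  "Souslin_subset S \<longleftrightarrow> Souslin_space (subtopology euclidean S)"

text \<open>
  \<open>r\<close> is a version of the Radon-Nikodym derivative \<open>d\<mu>/d\<nu>\<close>.  It may be measurable with respect
  to the completion of \<open>\<nu>\<close> only: a Souslin set need not be Borel, so extending a function on such
  a set by zero need not give a Borel function.
\<close>

definition is_density :: "'a measure \<Rightarrow> 'a measure \<Rightarrow> ('a \<Rightarrow> real) \<Rightarrow> bool" where
  "is_density \<nu> \<mu> r \<longleftrightarrow> r \<in> borel_measurable (completion \<nu>) \<and> (\<forall>z. 0 \<le> r z) \<and>
     (\<forall>B\<in>sets \<mu>. emeasure \<mu> B = (\<integral>\<^sup>+z\<in>B. ennreal (r z) \<partial>completion \<nu>))"

definition separately_continuous_on ::
  "'a::topological_space set \<Rightarrow> 'b::topological_space set \<Rightarrow> ('a \<Rightarrow> 'b \<Rightarrow> 'c::topological_space) \<Rightarrow> bool"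
  where
  "separately_continuous_on A B h \<longleftrightarrow>
     (\<forall>x\<in>A. continuous_on B (\<lambda>z. h x z)) \<and> (\<forall>z\<in>B. continuous_on A (\<lambda>x. h x z))"

text \<open>The library's \<open>prob_space.indep_var\<close> requires both random variables to have the same
  value type, hence the formulation through the generated \<open>\<sigma>\<close>-algebras.\<close>

definition indep_rv :: "'w measure \<Rightarrow> 'a measure \<Rightarrow> ('w \<Rightarrow> 'a) \<Rightarrow> 'b measure \<Rightarrow> ('w \<Rightarrow> 'b) \<Rightarrow> bool" where
  "indep_rv P N Y N' Y' \<longleftrightarrow>
     prob_space.indep_set P {Y -` B \<inter> space P | B. B \<in> sets N} {Y' -` B \<inter> space P | B. B \<in> sets N'}"

definition posterior :: "'a measure \<Rightarrow> ('a \<Rightarrow> 'b \<Rightarrow> real) \<Rightarrow> 'a set \<Rightarrow> 'b \<Rightarrow> real" where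
  "posterior \<mu> \<rho> U z =
     (LINT x|completion \<mu>. indicator U x * \<rho> x z) / (LINT x|completion \<mu>. \<rho> x z)"

definition setwise_continuous_on ::
  "'a set set \<Rightarrow> 'b::topological_space set \<Rightarrow> ('a set \<Rightarrow> 'b \<Rightarrow> real) \<Rightarrow> bool" where
  "setwise_continuous_on \<F> B m \<longleftrightarrow> (\<forall>U\<in>\<F>. continuous_on B (\<lambda>z. m U z))"

end

theory Submission
  imports Defs
begin

text \<open>
  Choquet's capacity argument shows that a finite Borel measure carried by a Souslin set, written
  as a continuous image \<open>f ` M\<close> of a Polish space, is carried up to \<open>e\<close> by \<open>f ` C\<close> for some compact
  \<open>C \<subseteq> M\<close>. Cutting such sets \<open>C\<close> into compact pieces of small diameter approximates the identity
  almost everywhere by countably valued Borel maps into the Souslin set, so a function continuous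
  in its first argument is an almost everywhere limit of functions that are visibly jointly
  measurable. For the second part, the hereditary Lindelof property of a Souslin space makes its
  compact subsets first countable. Hence continuity can be tested along sequences, where dominated
  convergence applies to the numerator and the denominator separately.
\<close>

section \<open>Countable bases, total boundedness and shrinking closed sets in metric spaces\<close>

context Metric_space
begin

lemma separable_imp_second_countable:
  assumes "separable_space mtopology"
  shows "second_countable mtopology"
proof -
  obtain D where D: "countable D" "D \<subseteq> M" "mtopology closure_of D = M"
    using assms unfolding separable_space_def by auto
  define \<B> where "\<B> = (\<lambda>(x, n). mball x (1 / real (Suc n))) ` (D \<times> UNIV)"
  have "\<exists>V\<in>\<B>. x \<in> V \<and> V \<subseteq> U" if U: "openin mtopology U" "x \<in> U" for U x
  proof -
    obtain r where r: "r > 0" "mball x r \<subseteq> U" and x: "x \<in> M"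
      using U by (metis openin_mtopology subsetD)
    obtain n where n: "1 / real (Suc n) < r / 2"
      using nat_approx_posE[of "r / 2"] r by auto
    have "x \<in> mtopology closure_of D" using D x by simp
    then obtain c where c: "c \<in> D" "d x c < 1 / real (Suc n)"
      unfolding metric_closure_of by (auto dest: spec[of _ "1 / real (Suc n)"])
    have "mball c (1 / real (Suc n)) \<subseteq> mball x r"
    proof
      fix y assume "y \<in> mball c (1 / real (Suc n))"
      then have "y \<in> M" "d c y < 1 / real (Suc n)" by auto
      then show "y \<in> mball x r"
        using triangle[of x c y] c D x n by auto
    qed
    moreover have "x \<in> mball c (1 / real (Suc n))"
      using c D x by (auto simp: commute)
    ultimately show ?thesis
      using c r unfolding \<B>_def by (intro bexI[of _ "mball c (1 / real (Suc n))"]) auto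
  qed
  moreover have "countable \<B>" unfolding \<B>_def using D by blast
  ultimately show ?thesis
    unfolding second_countable_def \<B>_def by (intro exI[of _ \<B>]) (auto simp: \<B>_def)
qed

text \<open>A ball that meets \<open>S\<close> but is centred elsewhere is recentred at a point of
  \<open>S\<close> inside it, which at most doubles the radius. Starting from \<open>e / 3\<close>
  leaves \<open>2 * e / 3\<close>, small enough for the open balls of radius \<open>e\<close> that
  \<open>mtotally_bounded\<close> asks for.\<close>

lemma mtotally_boundedI_centres:
  assumes "S \<subseteq> M"
    and cov: "\<And>e. e > 0 \<Longrightarrow> \<exists>K. finite K \<and> S \<subseteq> (\<Union>x\<in>K. mcball x e)"
  shows "mtotally_bounded S"
  unfolding mtotally_bounded_def
proof (intro allI impI)
  fix e :: real assume "e > 0"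
  then obtain K where K: "finite K" "S \<subseteq> (\<Union>x\<in>K. mcball x (e / 3))"
    using cov[of "e / 3"] by auto
  define p where "p x = (SOME y. y \<in> S \<inter> mcball x (e / 3))" for x
  define K' where "K' = {x \<in> K. S \<inter> mcball x (e / 3) \<noteq> {}}"
  have p: "p x \<in> S \<inter> mcball x (e / 3)" if "x \<in> K'" for x
    using that someI_ex[of "\<lambda>y. y \<in> S \<inter> mcball x (e / 3)"] unfolding p_def K'_def by blast
  have "S \<subseteq> (\<Union>x\<in>p ` K'. mball x e)"
  proof
    fix y assume y: "y \<in> S"
    then obtain x where x: "x \<in> K" "y \<in> mcball x (e / 3)" using K by auto
    then have x': "x \<in> K'" using y by (auto simp: K'_def)
    have "d (p x) y \<le> d (p x) x + d x y"
      using p[OF x'] x y assms(1) by (intro triangle) auto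
    also have "\<dots> < e"
      using p[OF x'] x \<open>e > 0\<close> commute[of x "p x"] by auto
    finally show "y \<in> (\<Union>x\<in>p ` K'. mball x e)"
      using p[OF x'] x' y assms(1) by (intro UN_I[of "p x"]) auto
  qed
  then show "\<exists>K. finite K \<and> K \<subseteq> S \<and> S \<subseteq> (\<Union>x\<in>K. mball x e)"
    using p K by (intro exI[of _ "p ` K'"]) (auto simp: K'_def)
qed

text \<open>A sequential form of Cantor's intersection theorem. All but finitely many
  \<open>y m\<close> lie in any given \<open>C n\<close>, so the finite covers make
  \<open>range y\<close> totally bounded. Completeness gives a convergent subsequence, and its limit
  lies in every closed \<open>C n\<close> because a tail of the subsequence does.\<close>

lemma decseq_closedin_subsequential_limit:
  assumes complete: mcomplete
    and C: "decseq C" "\<And>n. closedin mtopology (C n)"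
    and cov: "\<And>e. e > 0 \<Longrightarrow> \<exists>n K. finite K \<and> C n \<subseteq> (\<Union>x\<in>K. mcball x e)"
    and y: "\<And>n. y n \<in> C n"
  shows "\<exists>l r. l \<in> (\<Inter>n. C n) \<and> strict_mono r \<and> limitin mtopology (y \<circ> r) l sequentially"
proof -
  have CM: "C n \<subseteq> M" for n using closedin_subset[OF C(2)] by simp
  have "mtotally_bounded (range y)"
  proof (rule mtotally_boundedI_centres)
    show "range y \<subseteq> M" using y CM by auto
    fix e :: real assume "e > 0"
    then obtain n K where K: "finite K" "C n \<subseteq> (\<Union>x\<in>K. mcball x e)" using cov by blast
    have "range y \<subseteq> (\<Union>x\<in>K \<union> y ` {..n}. mcball x e)"
    proof
      fix z assume "z \<in> range y"
      then obtain m where m: "z = y m" by auto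
      show "z \<in> (\<Union>x\<in>K \<union> y ` {..n}. mcball x e)"
      proof (cases "m \<le> n")
        case True
        then have "z \<in> y ` {..n}" "z \<in> mcball z e" using y[of m] CM[of m] \<open>e > 0\<close> m by auto
        then show ?thesis by blast
      next
        case False
        then have "z \<in> C n" using decseqD[OF C(1), of n m] y[of m] m by auto
        then have "z \<in> (\<Union>x\<in>K. mcball x e)" using K(2) by (rule subsetD[rotated])
        then show ?thesis by blast
      qed
    qed
    then show "\<exists>K. finite K \<and> range y \<subseteq> (\<Union>x\<in>K. mcball x e)"
      using K by (intro exI[of _ "K \<union> y ` {..n}"]) auto
  qed
  then obtain r where r: "strict_mono r" "MCauchy (y \<circ> r)"
    unfolding mtotally_bounded_sequentially by blast
  then obtain l where l: "limitin mtopology (y \<circ> r) l sequentially"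
    using complete unfolding mcomplete_def by auto
  have "l \<in> C n" for n
  proof (rule limitin_closedin[OF l C(2)])
    have "(y \<circ> r) m \<in> C n" if "m \<ge> n" for m
      using y[of "r m"] decseqD[OF C(1), of n "r m"] seq_suble[OF r(1), of m] that by auto
    then show "\<forall>\<^sub>F m in sequentially. (y \<circ> r) m \<in> C n"
      unfolding eventually_sequentially by blast
  qed simp
  then show ?thesis using r l by blast
qed

end

section \<open>The hereditary Lindelof property of Souslin spaces\<close>

text \<open>Second countability may be lost under continuous images, but the Lindelof property is
  not. The preimage of \<open>\<Union>\<U>\<close> is second countable as a subspace of
  \<open>X\<close>, hence Lindelof, and \<open>f\<close> maps it onto
  \<open>\<Union>\<U>\<close>.\<close>

lemma hereditarily_Lindelof_continuous_image:
  assumes X: "second_countable X" and f: "continuous_map X Y f" "f ` topspace X = topspace Y"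
    and \<U>: "\<And>U. U \<in> \<U> \<Longrightarrow> openin Y U"
  shows "\<exists>\<V>. countable \<V> \<and> \<V> \<subseteq> \<U> \<and> \<Union>\<V> = \<Union>\<U>"
proof -
  have "second_countable (subtopology X {x \<in> topspace X. f x \<in> \<Union>\<U>})"
    using X by (rule second_countable_subtopology)
  then have "Lindelof_space (subtopology X {x \<in> topspace X. f x \<in> \<Union>\<U>})"
    by (rule second_countable_imp_Lindelof_space)
  moreover have "continuous_map (subtopology X {x \<in> topspace X. f x \<in> \<Union>\<U>}) (subtopology Y (\<Union>\<U>)) f"
    using f(1) by (auto simp: continuous_map_in_subtopology continuous_map_from_subtopology)
  moreover have "f ` topspace (subtopology X {x \<in> topspace X. f x \<in> \<Union>\<U>}) =
      topspace (subtopology Y (\<Union>\<U>))"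
    unfolding topspace_subtopology f(2)[symmetric] by auto
  ultimately have "Lindelof_space (subtopology Y (\<Union>\<U>))"
    by (rule Lindelof_space_continuous_map_image)
  then obtain \<V> where "countable \<V>" "\<V> \<subseteq> \<U>" "topspace Y \<inter> \<Union>\<U> \<subseteq> \<Union>\<V>"
    using \<U> unfolding Lindelof_space_subtopology by (metis inf_le2)
  moreover have "\<Union>\<U> \<subseteq> topspace Y" using \<U> openin_subset by blast
  ultimately show ?thesis by (intro exI[of _ \<V>]) blast
qed

lemma Souslin_space_hereditarily_Lindelof:
  assumes "Souslin_space T" and "\<And>U. U \<in> \<U> \<Longrightarrow> openin T U"
  shows "\<exists>\<V>. countable \<V> \<and> \<V> \<subseteq> \<U> \<and> \<Union>\<V> = \<Union>\<U>"
proof -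
  obtain M :: "real set" and d f where M: "Metric_space M d"
      "separable_space (Metric_space.mtopology M d)"
    and f: "continuous_map (Metric_space.mtopology M d) T f" "f ` M = topspace T"
    using assms(1) unfolding Souslin_space_def by blast
  interpret Metric_space M d by (fact M)
  show ?thesis
    by (rule hereditarily_Lindelof_continuous_image[OF separable_imp_second_countable[OF M(2)] f(1)])
      (use f assms in auto)
qed

section \<open>Compact approximation of measures carried by Souslin sets\<close>

text \<open>As \<open>S\<close> may fail to be measurable for \<open>\<mu>\<close>, its mass is
  expressed by the outer measure. A measurable hull attaining it contains \<open>S\<close> and so
  has full measure.\<close>

lemma outer_measure_of_conull:
  assumes "sets \<mu> = sets borel" "- S \<in> null_sets (completion \<mu>)"
  shows "outer_measure_of \<mu> S = emeasure \<mu> UNIV"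
proof -
  have sp: "space \<mu> = UNIV" using sets_eq_imp_space_eq[OF assms(1)] by simp
  obtain E where E: "E \<in> sets \<mu>" "S \<subseteq> E" "outer_measure_of \<mu> S = emeasure \<mu> E"
    using outer_measure_of_attain[of S \<mu>] sp by auto
  obtain N where N: "N \<in> null_sets \<mu>" "- S \<subseteq> N"
    using assms(2) unfolding null_sets_completion_iff2 by auto
  have "emeasure \<mu> E = emeasure \<mu> UNIV"
  proof (rule emeasure_eq_AE)
    show "AE x in \<mu>. (x \<in> E) = (x \<in> UNIV)"
      using AE_not_in[OF N(1)] by eventually_elim (use N E in auto)
    show "UNIV \<in> sets \<mu>" using sets.top[of \<mu>] sp by simp
  qed (fact E)
  then show ?thesis using E by simp
qed

text \<open>Outer measure is continuous along increasing sequences of arbitrary sets. Hence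
  \<open>M\<close> can be cut successively by finite unions of ever smaller closed balls while the
  outer measure of the image stays above a fixed \<open>c\<close>. The remaining intersection
  \<open>H\<close> is compact by completeness, and every open neighbourhood of its image has mass
  above \<open>c\<close>. The Lindelof property carries this over to the image of \<open>H\<close>
  itself.\<close>

lemma (in Metric_space) continuous_image_inner_compact:
  fixes f :: "'a \<Rightarrow> 'b::topological_space" and \<mu> :: "'b measure"
  assumes haus: "Hausdorff_space (euclidean :: 'b topology)"
    and complete: mcomplete and sep: "separable_space mtopology"
    and f: "continuous_map mtopology euclidean f"
    and \<mu>: "finite_measure \<mu>" "sets \<mu> = sets borel"
    and lind: "\<And>\<U> :: 'b set set. (\<And>U. U \<in> \<U> \<Longrightarrow> open U) \<Longrightarrow>
                  \<exists>\<V>. countable \<V> \<and> \<V> \<subseteq> \<U> \<and> \<Union>\<V> = \<Union>\<U>"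
    and full: "- f ` M \<in> null_sets (completion \<mu>)" and "e > 0"
  shows "\<exists>C. compactin mtopology C \<and> emeasure \<mu> (- f ` C) \<le> ennreal e"
proof (cases "measure \<mu> UNIV \<le> e")
  interpret \<mu>: finite_measure \<mu> by fact
  case True
  then show ?thesis
    by (intro exI[of _ "{}"]) (auto simp: \<mu>.emeasure_eq_measure intro!: ennreal_leI)
next
  case False
  interpret \<mu>: finite_measure \<mu> by fact
  \<comment> \<open>Here the total mass exceeds \<open>e\<close>, so \<open>ennreal\<close>
    truncates nothing, and \<open>c\<close> is strictly below the total mass because
    \<open>e > 0\<close>.\<close>
  define c where "c = ennreal (measure \<mu> UNIV - e)"
  have sp: "space \<mu> = UNIV" using sets_eq_imp_space_eq[OF \<mu>(2)] by simp
  have cM: "c < outer_measure_of \<mu> (f ` M)"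
    unfolding outer_measure_of_conull[OF \<mu>(2) full] c_def \<mu>.emeasure_eq_measure
    using \<open>e > 0\<close> False by (intro ennreal_lessI) auto
  obtain D where D: "countable D" "D \<subseteq> M" "mtopology closure_of D = M"
    using sep unfolding separable_space_def by auto
  have "M \<noteq> {}" using cM outer_measure_of_eq[of "{}" \<mu>] by auto
  then have "D \<noteq> {}" using D by auto
  define x where "x = from_nat_into D"
  have xD: "range x = D" using range_from_nat_into[OF \<open>D \<noteq> {}\<close> D(1)] unfolding x_def .
  define B where "B k n = (\<Union>i<n. mcball (x i) (1 / real (Suc k)))" for k n
  have UB: "(\<Union>n. B k n) = M" for k
  proof -
    have "y \<in> (\<Union>n. B k n)" if "y \<in> M" for y
    proof -
      have "y \<in> mtopology closure_of D" using D that by simp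
      then obtain a where a: "a \<in> D" "d y a < 1 / real (Suc k)"
        unfolding metric_closure_of by (auto dest: spec[of _ "1 / real (Suc k)"])
      then obtain i where "a = x i" using xD by auto
      then have "y \<in> B k (Suc i)"
        using a that D(2) unfolding B_def by (intro UN_I[of i]) (auto simp: commute)
      then show ?thesis by blast
    qed
    moreover have "B k n \<subseteq> M" for n unfolding B_def by auto
    ultimately show ?thesis by blast
  qed
  \<comment> \<open>The image of \<open>C n\<close> need not be measurable, so the invariant is
    stated with the outer measure. The step intersects with \<open>B n j\<close> for a
    \<open>j\<close> so large that the strict inequality survives.\<close>
  have "\<exists>C. \<forall>n. (closedin mtopology (C n) \<and> c < outer_measure_of \<mu> (f ` C n)) \<and>
      (C (Suc n) \<subseteq> C n \<and> (\<exists>K. finite K \<and> C (Suc n) \<subseteq> (\<Union>x\<in>K. mcball x (1 / real (Suc n)))))"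
  proof (rule dependent_nat_choice)
    show "\<exists>C. closedin mtopology C \<and> c < outer_measure_of \<mu> (f ` C)"
      using cM closedin_topspace[of mtopology] by (intro exI[of _ M]) simp
  next
    fix C n assume C: "closedin mtopology C \<and> c < outer_measure_of \<mu> (f ` C)"
    then have "C \<subseteq> M" using closedin_subset by fastforce
    have "(\<Union>j. f ` (C \<inter> B n j)) = f ` C"
    proof -
      have "(\<Union>j. f ` (C \<inter> B n j)) = f ` (C \<inter> (\<Union>j. B n j))" by blast
      also have "\<dots> = f ` C" using UB[of n] \<open>C \<subseteq> M\<close> by (simp add: Int_absorb2)
      finally show ?thesis .
    qed
    moreover have "incseq (\<lambda>j. f ` (C \<inter> B n j))"
      unfolding B_def by (intro monoI image_mono Int_mono UN_mono order_refl) auto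
    ultimately have "(SUP j. outer_measure_of \<mu> (f ` (C \<inter> B n j))) = outer_measure_of \<mu> (f ` C)"
      using SUP_outer_measure_of_incseq[of "\<lambda>j. f ` (C \<inter> B n j)" \<mu>] sp by simp
    then have "c < (SUP j. outer_measure_of \<mu> (f ` (C \<inter> B n j)))" using C by simp
    then obtain j where j: "c < outer_measure_of \<mu> (f ` (C \<inter> B n j))"
      unfolding less_SUP_iff by blast
    have "closedin mtopology (C \<inter> B n j)"
      unfolding B_def using C by (intro closedin_Int closedin_Union) (auto)
    moreover have "C \<inter> B n j \<subseteq> (\<Union>y\<in>x ` {..<j}. mcball y (1 / real (Suc n)))"
      unfolding B_def by auto
    ultimately show "\<exists>C'. (closedin mtopology C' \<and> c < outer_measure_of \<mu> (f ` C')) \<and>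
        (C' \<subseteq> C \<and> (\<exists>K. finite K \<and> C' \<subseteq> (\<Union>x\<in>K. mcball x (1 / real (Suc n)))))"
      using j by (intro exI[of _ "C \<inter> B n j"] conjI exI[of _ "x ` {..<j}"]) auto
  qed
  then obtain C where C: "\<And>n. closedin mtopology (C n)" "\<And>n. c < outer_measure_of \<mu> (f ` C n)"
    "\<And>n. C (Suc n) \<subseteq> C n"
    "\<And>n. \<exists>K. finite K \<and> C (Suc n) \<subseteq> (\<Union>x\<in>K. mcball x (1 / real (Suc n)))"
    by auto
  have dec: "decseq C" using C(3) by (intro decseq_SucI) auto
  have CM: "C n \<subseteq> M" for n using closedin_subset[OF C(1)] by simp
  have cov: "\<exists>n K. finite K \<and> C n \<subseteq> (\<Union>x\<in>K. mcball x r)" if r: "r > 0" for r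
  proof -
    obtain n where "1 / real (Suc n) < r" using nat_approx_posE[OF r] .
    then have "mcball y (1 / real (Suc n)) \<subseteq> mcball y r" for y by auto
    moreover obtain K where "finite K" "C (Suc n) \<subseteq> (\<Union>x\<in>K. mcball x (1 / real (Suc n)))"
      using C(4) by meson
    ultimately have "C (Suc n) \<subseteq> (\<Union>x\<in>K. mcball x r)" by blast
    then show ?thesis using \<open>finite K\<close> by blast
  qed
  define H where "H = (\<Inter>n. C n)"
  have lim: "\<exists>l r. l \<in> H \<and> strict_mono r \<and> limitin mtopology (y \<circ> r) l sequentially"
    if "\<And>n. y n \<in> C n" for y
    unfolding H_def by (rule decseq_closedin_subsequential_limit[OF complete dec C(1)]) (fact cov that)+
  have H: "compactin mtopology H"
    unfolding compactin_sequentially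
  proof (intro conjI allI impI)
    show "H \<subseteq> M" using CM unfolding H_def by auto
    fix s :: "nat \<Rightarrow> 'a" assume "range s \<subseteq> H"
    then have "s n \<in> C n" for n unfolding H_def by auto
    then show "\<exists>l r. l \<in> H \<and> strict_mono r \<and> limitin mtopology (s \<circ> r) l sequentially"
      by (rule lim)
  qed
  \<comment> \<open>This transfers the lower bound \<open>c\<close> from the sets \<open>C n\<close>
    to neighbourhoods of the image of \<open>H\<close>: points of \<open>C n\<close> mapped outside
    \<open>W\<close> would accumulate at a point of \<open>H\<close>, which \<open>f\<close> maps
    into \<open>W\<close>.\<close>
  have nbhd: "\<exists>n. f ` C n \<subseteq> W" if W: "open W" "f ` H \<subseteq> W" for W
  proof (rule ccontr)
    assume "\<not> ?thesis"
    then have "\<forall>n. \<exists>y. y \<in> C n \<and> f y \<notin> W" by blast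
    then obtain y where y: "\<And>n. y n \<in> C n" "\<And>n. f (y n) \<notin> W" by metis
    obtain l r where l: "l \<in> H" "strict_mono r" "limitin mtopology (y \<circ> r) l sequentially"
      using lim[OF y(1)] by blast
    have "limitin euclidean (f \<circ> (y \<circ> r)) (f l) sequentially"
      by (rule continuous_map_limit[OF f l(3)])
    moreover have "f l \<in> W" using l W by auto
    ultimately have "\<forall>\<^sub>F n in sequentially. (f \<circ> (y \<circ> r)) n \<in> W"
      using W(1) by (auto simp: tendsto_def)
    then show False using y(2) by auto
  qed
  \<comment> \<open>A member \<open>U\<close> is disjoint from an open neighbourhood of the image of
    \<open>H\<close>. That neighbourhood already uses up more than the total mass minus
    \<open>e\<close>, so at most \<open>e\<close> is left for \<open>U\<close>.\<close>
  define \<U> where "\<U> = {U. open U \<and> (\<exists>W. open W \<and> f ` H \<subseteq> W \<and> U \<inter> W = {})}"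
  have small: "emeasure \<mu> U \<le> ennreal e" if "U \<in> \<U>" for U
  proof -
    obtain W where W: "open U" "open W" "f ` H \<subseteq> W" "U \<inter> W = {}" using \<open>U \<in> \<U>\<close> unfolding \<U>_def by auto
    then have meas: "U \<in> sets \<mu>" "W \<in> sets \<mu>" using \<mu> by auto
    obtain n where n: "f ` C n \<subseteq> W" using nbhd[OF W(2,3)] ..
    have "c < outer_measure_of \<mu> W"
      using C(2)[of n] outer_measure_of_mono[OF n] by (rule less_le_trans)
    then have "measure \<mu> UNIV - e < measure \<mu> W"
      using meas False unfolding c_def by (simp add: \<mu>.emeasure_eq_measure ennreal_less_iff)
    moreover have "measure \<mu> U + measure \<mu> W = measure \<mu> (U \<union> W)"
      using meas W by (intro \<mu>.finite_measure_Union[symmetric]) auto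
    moreover have "measure \<mu> (U \<union> W) \<le> measure \<mu> UNIV"
      using \<mu>.bounded_measure[of "U \<union> W"] sp by simp
    ultimately show ?thesis by (auto simp: \<mu>.emeasure_eq_measure intro!: ennreal_leI)
  qed
  have cf: "compactin euclidean (f ` H)" using image_compactin[OF H f] .
  have UU: "\<Union>\<U> = - f ` H"
  proof -
    have "z \<in> \<Union>\<U>" if "z \<notin> f ` H" for z
    proof -
      have "compactin euclidean {z}" "disjnt {z} (f ` H)" using that by auto
      then obtain U W where "openin euclidean U" "openin euclidean W" "{z} \<subseteq> U" "f ` H \<subseteq> W" "disjnt U W"
        using haus cf unfolding Hausdorff_space_compact_sets by metis
      then have "open U" "open W" "z \<in> U" "f ` H \<subseteq> W" "U \<inter> W = {}"
        by (auto simp: disjnt_def)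
      then have "U \<in> \<U>" "z \<in> U" unfolding \<U>_def by auto
      then show ?thesis by blast
    qed
    moreover have "z \<notin> f ` H" if "z \<in> \<Union>\<U>" for z
      using that unfolding \<U>_def by auto
    ultimately show ?thesis by auto
  qed
  have openU: "open U" if "U \<in> \<U>" for U using that unfolding \<U>_def by simp
  obtain \<V> where V: "countable \<V>" "\<V> \<subseteq> \<U>" "\<Union>\<V> = \<Union>\<U>"
    using lind[of \<U>] openU by blast
  \<comment> \<open>Adding the empty set makes the countable subfamily nonempty, so that it can be
    enumerated by \<open>from_nat_into\<close>.\<close>
  have e0: "{} \<in> \<U>" unfolding \<U>_def by auto
  define v where "v = from_nat_into (insert {} \<V>)"
  have v: "range v = insert {} \<V>" unfolding v_def using V by (intro range_from_nat_into) auto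
  have vU: "v i \<in> \<U>" for i
  proof -
    have "v i \<in> insert {} \<V>" unfolding v[symmetric] by (rule rangeI)
    then show ?thesis using V(2) e0 by auto
  qed
  have "\<forall>i. \<exists>W. open W \<and> f ` H \<subseteq> W \<and> v i \<inter> W = {}" using vU unfolding \<U>_def by simp
  then obtain W where W: "\<And>i. open (W i)" "\<And>i. f ` H \<subseteq> W i" "\<And>i. v i \<inter> W i = {}"
    by metis
  \<comment> \<open>Finite unions stay in \<open>\<U>\<close>, since the separating neighbourhoods
    can be intersected. The bound \<open>e\<close> thus holds along an increasing sequence
    exhausting the complement, with no loss from summation.\<close>
  have Un: "(\<Union>i<n. v i) \<in> \<U>" for n
    unfolding \<U>_def
  proof (intro CollectI conjI exI)
    show "open (\<Union>i<n. v i)" using openU[OF vU] by auto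
    show "open (\<Inter>i<n. W i)" using W(1) by auto
    show "f ` H \<subseteq> (\<Inter>i<n. W i)" using W(2) by (intro INT_greatest)
    show "(\<Union>i<n. v i) \<inter> (\<Inter>i<n. W i) = {}" using W(3) by fastforce
  qed
  have "(\<Union>n. \<Union>i<n. v i) = - f ` H"
  proof -
    have "(\<Union>n. \<Union>i<n. v i) = \<Union>(range v)" by auto
    also have "\<dots> = - f ` H" using v V UU by simp
    finally show ?thesis .
  qed
  moreover have "(SUP n. emeasure \<mu> (\<Union>i<n. v i)) = emeasure \<mu> (\<Union>n. \<Union>i<n. v i)"
  proof (rule SUP_emeasure_incseq)
    show "range (\<lambda>n. \<Union>i<n. v i) \<subseteq> sets \<mu>" using Un openU \<mu>(2) by auto
    show "incseq (\<lambda>n. \<Union>i<n. v i)" by (intro monoI UN_mono) auto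
  qed
  moreover have "(SUP n. emeasure \<mu> (\<Union>i<n. v i)) \<le> ennreal e"
    using small[OF Un] by (rule SUP_least)
  ultimately show ?thesis using H by auto
qed

section \<open>Countably valued approximation of the identity\<close>

lemma (in Metric_space) limitin_dist_zero:
  assumes y: "limitin mtopology y l F" and z: "\<And>n. z n \<in> M" "\<And>n. y n \<in> M"
    and dist: "((\<lambda>n. d (y n) (z n)) \<longlongrightarrow> 0) F"
  shows "limitin mtopology z l F"
proof -
  have l: "l \<in> M" "((\<lambda>n. d (y n) l) \<longlongrightarrow> 0) F"
    using y unfolding limitin_metric_dist_null by auto
  have "((\<lambda>n. d (z n) l) \<longlongrightarrow> 0) F"
  proof (rule tendsto_sandwich[OF _ _ tendsto_const])
    show "((\<lambda>n. d (y n) (z n) + d (y n) l) \<longlongrightarrow> 0) F"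
      using tendsto_add[OF dist l(2)] by simp
    show "\<forall>\<^sub>F n in F. d (z n) l \<le> d (y n) (z n) + d (y n) l"
      using triangle[OF z(1) z(2) l(1)] by (auto simp: commute)
  qed auto
  then show ?thesis using l z unfolding limitin_metric_dist_null by auto
qed

text \<open>If \<open>f (p n)\<close> stayed outside a neighbourhood of \<open>x\<close> infinitely
  often, compactness would give a subsequence of \<open>p\<close> converging to some
  \<open>l\<close>. The same subsequence of \<open>m\<close> converges to \<open>l\<close> too, and
  \<open>f\<close> is constantly \<open>x\<close> along it, so \<open>f l = x\<close> by the
  Hausdorff property, a contradiction.\<close>

lemma (in Metric_space) compact_image_tendsto:
  fixes f :: "'a \<Rightarrow> 'b::topological_space"
  assumes haus: "Hausdorff_space (euclidean :: 'b topology)"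
    and f: "continuous_map mtopology euclidean f" and C: "compactin mtopology C"
    and m: "\<And>n. m n \<in> C" "\<And>n. f (m n) = x" and p: "\<And>n. p n \<in> C"
    and dist: "(\<lambda>n. d (m n) (p n)) \<longlonglongrightarrow> 0"
  shows "(\<lambda>n. f (p n)) \<longlonglongrightarrow> x"
proof (rule topological_tendstoI, rule ccontr)
  fix W assume W: "open W" "x \<in> W" and "\<not> (\<forall>\<^sub>F n in sequentially. f (p n) \<in> W)"
  then obtain r :: "nat \<Rightarrow> nat" where r: "strict_mono r" "\<And>n. f (p (r n)) \<notin> W"
    using not_eventually_sequentiallyD by blast
  have CM: "C \<subseteq> M" using compactin_subset_topspace[OF C] by simp
  have "range (p \<circ> r) \<subseteq> C" using p by auto
  then obtain l s where l: "l \<in> C" "strict_mono s" "limitin mtopology ((p \<circ> r) \<circ> s) l sequentially"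
    using C unfolding compactin_sequentially by blast
  have rs: "strict_mono (r \<circ> s)" using r l by (simp add: strict_mono_o)
  have "limitin mtopology (m \<circ> r \<circ> s) l sequentially"
  proof (rule limitin_dist_zero[OF l(3)])
    show "(\<lambda>n. d ((p \<circ> r \<circ> s) n) ((m \<circ> r \<circ> s) n)) \<longlonglongrightarrow> 0"
      using LIMSEQ_subseq_LIMSEQ[OF dist rs] by (simp add: o_def commute)
  qed (use m p CM in auto)
  then have "limitin euclidean (f \<circ> (m \<circ> r \<circ> s)) (f l) sequentially"
    by (rule continuous_map_limit[OF f])
  moreover have "f \<circ> (m \<circ> r \<circ> s) = (\<lambda>_. x)" using m by auto
  ultimately have "limitin euclidean (\<lambda>_. x) (f l) sequentially" by simp
  moreover have "limitin euclidean (\<lambda>_. x) x sequentially" by simp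
  ultimately have "f l = x"
    using haus by (metis limitin_Hausdorff_unique trivial_limit_sequentially)
  have "limitin euclidean (f \<circ> (p \<circ> r \<circ> s)) (f l) sequentially"
    by (rule continuous_map_limit[OF f l(3)])
  then have "\<forall>\<^sub>F n in sequentially. (f \<circ> (p \<circ> r \<circ> s)) n \<in> W"
    using W \<open>f l = x\<close> by (auto simp: tendsto_def)
  then show False using r(2) by auto
qed

text \<open>Almost every \<open>x\<close> has a preimage in one of countably many compact sets
  \<open>C j\<close>. Cutting \<open>C j\<close> into pieces of radius
  \<open>1 / real (Suc n)\<close> and choosing one point in each gives the values
  \<open>q n\<close>; the index \<open>k n x\<close> names a piece whose image contains
  \<open>x\<close>. The values lie in \<open>S\<close>, where continuity of the functions to be
  approximated will be available.\<close>

lemma Souslin_simple_approximation: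
  fixes \<mu> :: "'a::topological_space measure"
  assumes souslin: "Souslin_space (euclidean :: 'a topology)"
    and \<mu>: "finite_measure \<mu>" "sets \<mu> = sets borel"
    and S: "Souslin_subset S" "- S \<in> null_sets (completion \<mu>)"
  shows "\<exists>(q :: nat \<Rightarrow> nat \<Rightarrow> 'a) k. (\<forall>n. k n \<in> borel \<rightarrow>\<^sub>M count_space UNIV) \<and>
     (AE x in \<mu>. (\<forall>n. q n (k n x) \<in> S) \<and> (\<lambda>n. q n (k n x)) \<longlonglongrightarrow> x)"
proof -
  obtain M :: "real set" and d f where M: "Metric_space M d" "Metric_space.mcomplete M d"
      "separable_space (Metric_space.mtopology M d)"
    and f: "continuous_map (Metric_space.mtopology M d) (top_of_set S) f" "f ` M = S"
    using S(1) unfolding Souslin_subset_def Souslin_space_def by auto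
  interpret Metric_space M d by (fact M)
  interpret \<mu>: finite_measure \<mu> by fact
  have haus: "Hausdorff_space (euclidean :: 'a topology)"
    using souslin unfolding Souslin_space_def by simp
  have f': "continuous_map mtopology euclidean f"
    using f(1) by (rule continuous_map_into_fulltopology)
  have lind: "\<exists>\<V>. countable \<V> \<and> \<V> \<subseteq> \<U> \<and> \<Union>\<V> = \<Union>\<U>"
    if "\<And>U. U \<in> \<U> \<Longrightarrow> open U" for \<U> :: "'a set set"
    using Souslin_space_hereditarily_Lindelof[OF souslin] that by auto
  have "\<exists>C. compactin mtopology C \<and> emeasure \<mu> (- f ` C) \<le> ennreal (1 / real (Suc j))" for j
    using S(2) f(2)
    by (intro continuous_image_inner_compact[OF haus M(2,3) f' \<mu> lind]) auto
  then obtain C where C: "\<And>j. compactin mtopology (C j)"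
    "\<And>j. emeasure \<mu> (- f ` C j) \<le> ennreal (1 / real (Suc j))" by metis
  have CM: "C j \<subseteq> M" for j using compactin_subset_topspace[OF C(1)] by simp
  obtain D where D: "countable D" "D \<subseteq> M" "mtopology closure_of D = M"
    using M(3) unfolding separable_space_def by auto
  define c where "c = from_nat_into D"
  \<comment> \<open>The number \<open>t\<close> codes a pair of an index \<open>j\<close> of a
    compact set and an index of a centre. In \<open>E\<close> the images of all earlier compact sets
    are removed, so that \<open>j\<close> is determined by \<open>x\<close> alone.\<close>
  define G where "G n t = C (fst (prod_decode t)) \<inter> mcball (c (snd (prod_decode t))) (1 / real (Suc n))" for n t
  define E where "E n t = f ` G n t - (\<Union>j<fst (prod_decode t). f ` C j)" for n t
  \<comment> \<open>The choice is arbitrary where \<open>G n t\<close> is empty, but such a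
    \<open>t\<close> is never selected for an \<open>x\<close> in the union of the images of the
    \<open>C j\<close>.\<close>
  define q where "q n t = f (SOME p. p \<in> G n t)" for n t
  define k where "k n x = (LEAST t. x \<in> E n t)" for n x
  have borel_im: "f ` H \<in> sets borel" if "compactin mtopology H" for H
    using compactin_imp_closedin[OF haus image_compactin[OF that f']] by simp
  have G: "compactin mtopology (G n t)" for n t
    unfolding G_def using C(1) by (simp add: compact_Int_closedin)
  have E: "E n t \<in> sets borel" for n t
    unfolding E_def using borel_im G C by (intro sets.Diff sets.finite_UN) auto
  have k: "k n \<in> borel \<rightarrow>\<^sub>M count_space UNIV" for n
    unfolding k_def using E by measurable
  have lim: "(\<forall>n. q n (k n x) \<in> S) \<and> (\<lambda>n. q n (k n x)) \<longlonglongrightarrow> x" if x: "x \<in> (\<Union>j. f ` C j)" for x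
  proof -
    define j where "j = (LEAST j. x \<in> f ` C j)"
    have j: "x \<in> f ` C j" using x unfolding j_def by (auto intro: LeastI)
    have j': "x \<notin> f ` C i" if "i < j" for i using that not_less_Least unfolding j_def by blast
    obtain y where y: "y \<in> C j" "f y = x" using j by auto
    have "\<exists>t. x \<in> E n t" for n
    proof -
      have "y \<in> mtopology closure_of D" using D y CM by auto
      then obtain a where a: "a \<in> D" "d y a < 1 / real (Suc n)"
        unfolding metric_closure_of by (auto dest: spec[of _ "1 / real (Suc n)"])
      then obtain i where "a = c i" using from_nat_into_surj[OF D(1)] unfolding c_def by metis
      then have "y \<in> G n (prod_encode (j, i))"
        using a y CM D(2) unfolding G_def by (auto simp: commute)
      then have "x \<in> E n (prod_encode (j, i))"
        using y j' unfolding E_def by auto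
      then show ?thesis ..
    qed
    then have xE: "x \<in> E n (k n x)" for n unfolding k_def by (auto intro: LeastI_ex)
    \<comment> \<open>Since \<open>j\<close> does not vary with \<open>n\<close>, all chosen points
      lie in the single compact set \<open>C j\<close>, as \<open>compact_image_tendsto\<close>
      requires.\<close>
    have fst_k: "fst (prod_decode (k n x)) = j" for n
    proof (rule antisym)
      show "fst (prod_decode (k n x)) \<le> j"
        using xE[of n] j unfolding E_def by (auto simp: not_less[symmetric])
      have "x \<in> f ` C (fst (prod_decode (k n x)))" using xE[of n] unfolding E_def G_def by blast
      then show "j \<le> fst (prod_decode (k n x))" using j' by (auto simp: not_less[symmetric])
    qed
    \<comment> \<open>As \<open>f\<close> need not be injective, the preimage \<open>m n\<close> of
      \<open>x\<close> in the selected piece may change with \<open>n\<close>.\<close>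
    have "\<exists>m. m \<in> G n (k n x) \<and> f m = x" for n using xE[of n] unfolding E_def by auto
    then obtain m where m: "\<And>n. m n \<in> G n (k n x)" "\<And>n. f (m n) = x" by metis
    define p where "p n = (SOME p. p \<in> G n (k n x))" for n
    have p: "p n \<in> G n (k n x)" for n unfolding p_def using m(1) by (rule someI)
    have GC: "G n (k n x) \<subseteq> C j" for n unfolding G_def fst_k by auto
    have dist: "(\<lambda>n. d (m n) (p n)) \<longlonglongrightarrow> 0"
    proof (rule tendsto_sandwich[OF _ _ tendsto_const])
      show "(\<lambda>n. 2 * (1 / real (Suc n))) \<longlonglongrightarrow> 0"
        using tendsto_mult_right_zero[OF LIMSEQ_Suc[OF lim_1_over_n[where 'a=real]], of 2] by simp
      show "\<forall>\<^sub>F n in sequentially. d (m n) (p n) \<le> 2 * (1 / real (Suc n))"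
      proof (intro always_eventually allI)
        fix n
        let ?a = "c (snd (prod_decode (k n x)))"
        have a: "m n \<in> mcball ?a (1 / real (Suc n))" "p n \<in> mcball ?a (1 / real (Suc n))"
          using m(1)[of n] p[of n] unfolding G_def by auto
        then have "d (m n) (p n) \<le> d (m n) ?a + d ?a (p n)" by (intro triangle) auto
        then show "d (m n) (p n) \<le> 2 * (1 / real (Suc n))" using a by (simp add: commute)
      qed
    qed auto
    have "m n \<in> C j" "p n \<in> C j" for n using m p GC by blast+
    then have "(\<lambda>n. f (p n)) \<longlonglongrightarrow> x"
      using m(2) dist by (intro compact_image_tendsto[OF haus f' C(1)]) auto
    moreover have "p n \<in> M" for n using p GC CM by blast
    ultimately show ?thesis unfolding q_def p_def[symmetric] using f(2) by auto
  qed
  have "AE x in \<mu>. x \<in> (\<Union>j. f ` C j)"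
  proof (rule AE_I)
    show "{x \<in> space \<mu>. x \<notin> (\<Union>j. f ` C j)} \<subseteq> - (\<Union>j. f ` C j)" by auto
    have meas: "- f ` C j \<in> sets \<mu>" "- (\<Union>j. f ` C j) \<in> sets \<mu>" for j
      using borel_im[OF C(1)] \<mu>(2) by (auto intro!: borel_comp sets.countable_UN)
    have le: "emeasure \<mu> (- (\<Union>j. f ` C j)) \<le> ennreal (1 / real (Suc n))" for n
      using C(2)[of n] meas by (intro order_trans[OF emeasure_mono C(2)[of n]]) auto
    have "emeasure \<mu> (- (\<Union>j. f ` C j)) \<le> 0"
    proof (rule ennreal_le_epsilon)
      fix e :: real assume "e > 0"
      then obtain n where "1 / real (Suc n) < e" using nat_approx_posE by blast
      then show "emeasure \<mu> (- (\<Union>j. f ` C j)) \<le> 0 + ennreal e"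
        using order_trans[OF le[of n] ennreal_leI[of _ e]] by simp
    qed
    then show "emeasure \<mu> (- (\<Union>j. f ` C j)) = 0" by simp
    show "- (\<Union>j. f ` C j) \<in> sets \<mu>" by fact
  qed
  then have "AE x in \<mu>. (\<forall>n. q n (k n x) \<in> S) \<and> (\<lambda>n. q n (k n x)) \<longlonglongrightarrow> x"
    by eventually_elim (rule lim)
  then show ?thesis using k by blast
qed

section \<open>Joint measurability with respect to the completed product\<close>

lemma (in complete_measure) measurable_cong_AE_complete:
  assumes f: "f \<in> M \<rightarrow>\<^sub>M N" and g: "\<And>x. x \<in> space M \<Longrightarrow> g x \<in> space N"
    and ae: "AE x in M. f x = g x"
  shows "g \<in> M \<rightarrow>\<^sub>M N"
proof (rule measurableI)
  fix B assume "B \<in> sets N"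
  show "g -` B \<inter> space M \<in> sets M"
  proof (rule in_sets_AE)
    show "AE x in M. x \<in> f -` B \<inter> space M \<longleftrightarrow> x \<in> g -` B \<inter> space M"
      using ae by eventually_elim auto
    show "f -` B \<inter> space M \<in> sets M" using f \<open>B \<in> sets N\<close> by (rule measurable_sets)
  qed auto
qed (fact g)

lemma (in complete_measure) borel_measurable_LIMSEQ_AE_complete:
  fixes s :: "nat \<Rightarrow> 'a \<Rightarrow> real"
  assumes [measurable]: "\<And>n. s n \<in> borel_measurable M"
    and ae: "AE x in M. (\<lambda>n. s n x) \<longlonglongrightarrow> g x"
  shows "g \<in> borel_measurable M"
proof (rule measurable_cong_AE_complete)
  show "(\<lambda>x. lim (\<lambda>n. s n x)) \<in> borel_measurable M" by measurable
  show "AE x in M. lim (\<lambda>n. s n x) = g x"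
    using ae by eventually_elim (rule limI)
qed auto

lemma AE_pair_measure_fst:
  assumes "sigma_finite_measure N" "AE x in M. Q x"
  shows "AE p in M \<Otimes>\<^sub>M N. Q (fst p)"
proof -
  interpret N: sigma_finite_measure N by fact
  obtain T where T: "\<And>x. x \<in> space M - T \<Longrightarrow> Q x" "T \<in> null_sets M"
    using AE_E3[OF assms(2)] by blast
  show ?thesis
  proof (rule AE_I')
    show "T \<times> space N \<in> null_sets (M \<Otimes>\<^sub>M N)" using T(2) by auto
    show "{p \<in> space (M \<Otimes>\<^sub>M N). \<not> Q (fst p)} \<subseteq> T \<times> space N"
      using T(1) by (force simp: space_pair_measure)
  qed
qed

lemma AE_pair_measure_snd:
  assumes "sigma_finite_measure N" "AE x in N. Q x"
  shows "AE p in M \<Otimes>\<^sub>M N. Q (snd p)"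
proof -
  interpret N: sigma_finite_measure N by fact
  obtain T where T: "\<And>x. x \<in> space N - T \<Longrightarrow> Q x" "T \<in> null_sets N"
    using AE_E3[OF assms(2)] by blast
  show ?thesis
  proof (rule AE_I')
    show "space M \<times> T \<in> null_sets (M \<Otimes>\<^sub>M N)" using T(2) by auto
    show "{p \<in> space (M \<Otimes>\<^sub>M N). \<not> Q (snd p)} \<subseteq> space M \<times> T"
      using T(1) by (force simp: space_pair_measure)
  qed
qed

text \<open>A null set \<open>T\<close> of \<open>N\<close> pulls back to the strip
  \<open>space M \<times> T\<close>, which is null for the product. This is what allows the target
  \<sigma>-algebra to be completed.\<close>

lemma measurable_snd_completion:
  assumes "sigma_finite_measure N"
  shows "snd \<in> completion (M \<Otimes>\<^sub>M N) \<rightarrow>\<^sub>M completion N"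
proof (rule completion.measurable_completion2)
  interpret N: sigma_finite_measure N by fact
  show "snd \<in> completion (M \<Otimes>\<^sub>M N) \<rightarrow>\<^sub>M N" by (intro measurable_completion measurable_snd)
  show "null_sets N \<subseteq> null_sets (distr (completion (M \<Otimes>\<^sub>M N)) N snd)"
  proof
    fix T assume T: "T \<in> null_sets N"
    have "snd -` T \<inter> space (M \<Otimes>\<^sub>M N) = space M \<times> T"
      using sets.sets_into_space[of T N] T by (auto simp: space_pair_measure null_sets_def)
    moreover have "space M \<times> T \<in> null_sets (M \<Otimes>\<^sub>M N)" using T by auto
    ultimately show "T \<in> null_sets (distr (completion (M \<Otimes>\<^sub>M N)) N snd)"
      using T by (auto simp: distr_completion null_sets_def emeasure_distr)
  qed
qed

lemma AE_completion_conull: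
  assumes "- S \<in> null_sets (completion M)"
  shows "AE x in M. x \<in> S"
  using AE_not_in[OF assms] by (simp add: AE_completion_iff)

text \<open>Replacing \<open>x\<close> by \<open>q n (k n x)\<close> leaves a function that depends
  on \<open>z\<close> alone on each of countably many measurable strips, hence is measurable.
  Continuity in the first argument makes these functions converge to \<open>h\<close> almost
  everywhere, and completeness absorbs the exceptional set.\<close>

lemma borel_measurable_completion_Caratheodory:
  fixes \<mu> :: "'a::topological_space measure" and h :: "'a \<Rightarrow> 'b \<Rightarrow> real"
  assumes souslin: "Souslin_space (euclidean :: 'a topology)"
    and \<mu>: "finite_measure \<mu>" "sets \<mu> = sets borel"
    and \<nu>: "sigma_finite_measure \<nu>"
    and S: "Souslin_subset S" "- S \<in> null_sets (completion \<mu>)"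
    and cont: "AE z in \<nu>. continuous_on S (\<lambda>x. h x z)"
    and meas: "\<And>x. h x \<in> borel_measurable (completion \<nu>)"
  shows "(\<lambda>(x, z). h x z) \<in> borel_measurable (completion (\<mu> \<Otimes>\<^sub>M \<nu>))"
proof -
  obtain q :: "nat \<Rightarrow> nat \<Rightarrow> 'a" and k where k: "\<And>n. k n \<in> borel \<rightarrow>\<^sub>M count_space UNIV"
    and lim: "AE x in \<mu>. (\<forall>n. q n (k n x) \<in> S) \<and> (\<lambda>n. q n (k n x)) \<longlonglongrightarrow> x"
    using Souslin_simple_approximation[OF souslin \<mu> S] by blast
  show ?thesis
  proof (rule completion.borel_measurable_LIMSEQ_AE_complete)
    fix n
    have "(\<lambda>p. h (q n (k n (fst p))) (snd p)) \<in> borel_measurable (completion (\<mu> \<Otimes>\<^sub>M \<nu>))"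
    proof (rule measurable_compose_countable)
      show "(\<lambda>p. h (q n i) (snd p)) \<in> borel_measurable (completion (\<mu> \<Otimes>\<^sub>M \<nu>))" for i
        using measurable_compose[OF measurable_snd_completion[OF \<nu>] meas] .
      have "k n \<in> \<mu> \<rightarrow>\<^sub>M count_space UNIV" using k measurable_cong_sets[OF \<mu>(2) refl] by blast
      then show "(\<lambda>p. k n (fst p)) \<in> completion (\<mu> \<Otimes>\<^sub>M \<nu>) \<rightarrow>\<^sub>M count_space UNIV"
        by (intro measurable_completion measurable_compose[OF measurable_fst])
    qed
    then show "(\<lambda>p. case p of (x, z) \<Rightarrow> h (q n (k n x)) z) \<in> borel_measurable (completion (\<mu> \<Otimes>\<^sub>M \<nu>))"
      by (simp add: case_prod_beta')
  next
    have "AE p in \<mu> \<Otimes>\<^sub>M \<nu>. (\<lambda>n. case p of (x, z) \<Rightarrow> h (q n (k n x)) z) \<longlonglongrightarrow> (case p of (x, z) \<Rightarrow> h x z)"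
      using AE_pair_measure_fst[OF \<nu> lim] AE_pair_measure_fst[OF \<nu> AE_completion_conull[OF S(2)]]
        AE_pair_measure_snd[OF \<nu> cont, of \<mu>]
    proof eventually_elim
      case (elim p)
      then have "(\<lambda>n. h (q n (k n (fst p))) (snd p)) \<longlonglongrightarrow> h (fst p) (snd p)"
        using continuous_on_tendsto_compose[of S "\<lambda>x. h x (snd p)" "\<lambda>n. q n (k n (fst p))" "fst p"]
        by simp
      then show ?case by (simp add: case_prod_beta)
    qed
    then show "AE p in completion (\<mu> \<Otimes>\<^sub>M \<nu>).
        (\<lambda>n. case p of (x, z) \<Rightarrow> h (q n (k n x)) z) \<longlonglongrightarrow> (case p of (x, z) \<Rightarrow> h x z)"
      by (rule AE_completion)
  qed
qed

section \<open>Sequential continuity on compact sets and integrals with a parameter\<close>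

text \<open>Sequences suffice because countably many neighbourhoods \<open>U i\<close> of
  \<open>z\<close> already separate it from all other points: by the Lindelof property, the
  complement of \<open>z\<close> is a countable union of open sets \<open>v i\<close>, each disjoint
  from \<open>U i\<close>. Inside a compact set such neighbourhoods force convergence to
  \<open>z\<close>.\<close>

lemma tendsto_within_Souslin_compactI:
  fixes h :: "'a::topological_space \<Rightarrow> 'b::topological_space"
  assumes souslin: "Souslin_space (euclidean :: 'a topology)"
    and K: "compact K" "S \<subseteq> K"
    and seq: "\<And>s :: nat \<Rightarrow> 'a. (\<And>n. s n \<in> S) \<Longrightarrow> s \<longlonglongrightarrow> z \<Longrightarrow> (\<lambda>n. h (s n)) \<longlonglongrightarrow> l"
  shows "(h \<longlongrightarrow> l) (at z within S)"
proof (rule topological_tendstoI, rule ccontr)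
  fix W assume W: "open W" "l \<in> W" and nev: "\<not> (\<forall>\<^sub>F y in at z within S. h y \<in> W)"
  have haus: "Hausdorff_space (euclidean :: 'a topology)"
    using souslin unfolding Souslin_space_def by simp
  define \<V> where "\<V> = {V. open V \<and> (\<exists>U. open U \<and> z \<in> U \<and> U \<inter> V = {})}"
  have "\<exists>V\<in>\<V>. y \<in> V" if "y \<noteq> z" for y
  proof -
    have "\<exists>U V. openin euclidean U \<and> openin euclidean V \<and> z \<in> U \<and> y \<in> V \<and> disjnt U V"
      using haus that unfolding Hausdorff_space_def by simp
    then obtain U V where "open U" "open V" "z \<in> U" "y \<in> V" "U \<inter> V = {}"
      by (auto simp: disjnt_def)
    then have "V \<in> \<V>" unfolding \<V>_def by auto
    then show ?thesis using \<open>y \<in> V\<close> by (rule bexI[rotated])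
  qed
  then have UV: "y \<in> \<Union>\<V>" if "y \<noteq> z" for y using that by blast
  have "\<exists>\<W>. countable \<W> \<and> \<W> \<subseteq> \<V> \<and> \<Union>\<W> = \<Union>\<V>"
    by (rule Souslin_space_hereditarily_Lindelof[OF souslin]) (simp add: \<V>_def)
  then obtain \<W> where \<W>: "countable \<W>" "\<W> \<subseteq> \<V>" "\<Union>\<W> = \<Union>\<V>" by (elim exE conjE)
  have e: "{} \<in> \<V>" unfolding \<V>_def by auto
  define v where "v = from_nat_into (insert {} \<W>)"
  have v: "range v = insert {} \<W>" unfolding v_def using \<W> by (intro range_from_nat_into) auto
  have vV: "v i \<in> \<V>" for i
  proof -
    have "v i \<in> insert {} \<W>" unfolding v[symmetric] by (rule rangeI)
    then show ?thesis using \<W>(2) e by auto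
  qed
  have vo: "open (v i)" for i using vV[of i] unfolding \<V>_def by simp
  have "\<forall>i. \<exists>U. open U \<and> z \<in> U \<and> U \<inter> v i = {}" using vV unfolding \<V>_def by simp
  then obtain U where U: "\<And>i. open (U i)" "\<And>i. z \<in> U i" "\<And>i. U i \<inter> v i = {}" by metis
  \<comment> \<open>Finite intersections of the \<open>U i\<close> are neighbourhoods of
    \<open>z\<close>, so each contains a point of \<open>S\<close> violating the limit.\<close>
  have "\<exists>y\<in>S. y \<in> (\<Inter>i\<le>n. U i) \<and> h y \<notin> W" for n
  proof (rule ccontr)
    assume "\<not> ?thesis"
    then have "\<forall>y\<in>S. y \<in> (\<Inter>i\<le>n. U i) \<longrightarrow> h y \<in> W" by blast
    moreover have "open (\<Inter>i\<le>n. U i)" using U(1) by auto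
    moreover have "z \<in> (\<Inter>i\<le>n. U i)" using U(2) by auto
    ultimately have "\<forall>\<^sub>F y in at z within S. h y \<in> W"
      unfolding eventually_at_topological by blast
    then show False using nev by contradiction
  qed
  then obtain s where s: "\<And>n. s n \<in> S" "\<And>n. s n \<in> (\<Inter>i\<le>n. U i)" "\<And>n. h (s n) \<notin> W" by metis
  have "s \<longlonglongrightarrow> z"
  proof (rule topological_tendstoI)
    fix G assume G: "open G" "z \<in> G"
    \<comment> \<open>Finitely many \<open>v i\<close> cover the part of \<open>K\<close> outside
      \<open>G\<close>. Once \<open>n\<close> exceeds their indices, \<open>s n\<close> lies in the
      corresponding \<open>U i\<close>, avoids these \<open>v i\<close> and therefore lies in
      \<open>G\<close>.\<close>
    have "compact (K \<inter> - G)" using K(1) G(1) by (intro compact_Int_closed) auto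
    moreover have "K \<inter> - G \<subseteq> (\<Union>i. v i)"
    proof
      fix y assume "y \<in> K \<inter> - G"
      then have "y \<in> \<Union>\<V>" using G by (intro UV) auto
      then show "y \<in> (\<Union>i. v i)" using \<W>(3) v by auto
    qed
    ultimately obtain I where I: "finite I" "K \<inter> - G \<subseteq> (\<Union>i\<in>I. v i)"
      using vo by (metis compactE_image)
    have "s n \<in> G" if "Max (insert 0 I) \<le> n" for n
    proof (rule ccontr)
      assume "s n \<notin> G"
      then obtain i where i: "i \<in> I" "s n \<in> v i" using I s(1)[of n] K(2) by auto
      then have "i \<le> n" using that I(1) by auto
      then have "s n \<in> U i" using s(2)[of n] by auto
      then show False using i U(3)[of i] by auto
    qed
    then show "\<forall>\<^sub>F n in sequentially. s n \<in> G" unfolding eventually_sequentially by blast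
  qed
  then have "(\<lambda>n. h (s n)) \<longlonglongrightarrow> l" by (rule seq[OF s(1)])
  then have "\<forall>\<^sub>F n in sequentially. h (s n) \<in> W" using W by (rule topological_tendstoD)
  then show False using s(3) by auto
qed

text \<open>The preimage of an open set agrees on \<open>S\<close> with an open set
  \<open>V\<close>, hence differs from \<open>V\<close> by a null set.\<close>

lemma continuous_on_conull_borel_measurable_completion:
  fixes h :: "'a::topological_space \<Rightarrow> 'b::topological_space"
  assumes h: "continuous_on S h" and S: "- S \<in> null_sets (completion \<mu>)" and \<mu>: "sets \<mu> = sets borel"
  shows "h \<in> borel_measurable (completion \<mu>)"
proof (rule borel_measurableI)
  fix W :: "'b set" assume "open W"
  have sp: "space (completion \<mu>) = UNIV" using sets_eq_imp_space_eq[OF \<mu>] by simp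
  obtain V where V: "open V" "V \<inter> S = h -` W \<inter> S"
    using h \<open>open W\<close> unfolding continuous_on_open_invariant by blast
  show "h -` W \<inter> space (completion \<mu>) \<in> sets (completion \<mu>)"
  proof (rule completion.in_sets_AE)
    show "AE x in completion \<mu>. x \<in> V \<longleftrightarrow> x \<in> h -` W \<inter> space (completion \<mu>)"
      using AE_completion[OF AE_completion_conull[OF S]] by eventually_elim (use V sp in auto)
    show "V \<in> sets (completion \<mu>)" using V(1) \<mu> by (intro sets_completionI_sets) auto
  qed auto
qed

text \<open>Dominated convergence works along sequences only, which is why compactness and the
  Souslin property enter. The supremum over \<open>K\<close> dominates all
  \<open>\<rho> x (s n)\<close> at once.\<close>

lemma continuous_on_integral_Souslin_compact:
  fixes \<rho> :: "'a \<Rightarrow> 'b::topological_space \<Rightarrow> real"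
  assumes souslin: "Souslin_space (euclidean :: 'b topology)" and K: "compact K"
    and nonneg: "\<And>x z. 0 \<le> \<rho> x z"
    and meas: "\<And>z. z \<in> A \<Longrightarrow> (\<lambda>x. \<rho> x z) \<in> borel_measurable M"
    and cont: "AE x in M. continuous_on A (\<rho> x)"
    and sup: "(\<lambda>x. SUP z\<in>K. ennreal (\<rho> x z)) \<in> borel_measurable M"
      "(\<integral>\<^sup>+x. (SUP z\<in>K. ennreal (\<rho> x z)) \<partial>M) < \<infinity>"
    and U[measurable]: "U \<in> sets M"
  shows "continuous_on (K \<inter> A) (\<lambda>z. LINT x|M. indicator U x * \<rho> x z)"
  unfolding continuous_on_def
proof
  fix z assume z: "z \<in> K \<inter> A"
  define w where "w x = (SUP z\<in>K. ennreal (\<rho> x z))" for x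
  have w: "w \<in> borel_measurable M" "(\<integral>\<^sup>+x. w x \<partial>M) < \<infinity>" using sup unfolding w_def by auto
  then have fin: "AE x in M. w x \<noteq> \<infinity>" by (intro nn_integral_noteq_infinite) auto
  show "((\<lambda>z. LINT x|M. indicator U x * \<rho> x z) \<longlongrightarrow> (LINT x|M. indicator U x * \<rho> x z)) (at z within K \<inter> A)"
  proof (rule tendsto_within_Souslin_compactI[OF souslin K])
    fix s :: "nat \<Rightarrow> 'b" assume s: "\<And>n. s n \<in> K \<inter> A" "s \<longlonglongrightarrow> z"
    show "(\<lambda>n. LINT x|M. indicator U x * \<rho> x (s n)) \<longlonglongrightarrow> (LINT x|M. indicator U x * \<rho> x z)"
    proof (rule integral_dominated_convergence)
      show "(\<lambda>x. indicator U x * \<rho> x z) \<in> borel_measurable M"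
        using meas[of z] z by simp
      show "(\<lambda>x. indicator U x * \<rho> x (s n)) \<in> borel_measurable M" for n
        using meas[of "s n"] s by simp
      \<comment> \<open>Only an inequality holds in general, because \<open>enn2real\<close> sends
        infinity to 0. For the same reason the domination below is claimed only almost everywhere,
        where \<open>w\<close> is finite.\<close>
      have "(\<integral>\<^sup>+x. ennreal (norm (enn2real (w x))) \<partial>M) \<le> (\<integral>\<^sup>+x. w x \<partial>M)"
        by (intro nn_integral_mono) (simp add: ennreal_enn2real_if)
      then show "integrable M (\<lambda>x. enn2real (w x))"
        using w by (intro integrableI_bounded) (auto elim: le_less_trans)
      show "AE x in M. (\<lambda>n. indicator U x * \<rho> x (s n)) \<longlonglongrightarrow> indicator U x * \<rho> x z"
        using cont
      proof eventually_elim
        case (elim x)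
        then have "(\<lambda>n. \<rho> x (s n)) \<longlonglongrightarrow> \<rho> x z"
          using s z by (intro continuous_on_tendsto_compose[of A "\<rho> x" s]) auto
        then show ?case by (rule tendsto_mult_left)
      qed
      show "AE x in M. norm (indicator U x * \<rho> x (s n)) \<le> enn2real (w x)" for n
        using fin
      proof eventually_elim
        case (elim x)
        have "ennreal (\<rho> x (s n)) \<le> w x" unfolding w_def using s(1)[of n] by (intro SUP_upper) auto
        then have "enn2real (ennreal (\<rho> x (s n))) \<le> enn2real (w x)"
          using elim by (intro enn2real_mono) (auto simp: top.not_eq_extremum)
        then show ?case using nonneg[of x "s n"] by (auto simp: indicator_def)
      qed
    qed
  qed auto
qed

section \<open>Measurability of the likelihood and setwise continuity of the posterior\<close>

theorem theorem3p4:
  fixes P :: "'w measure"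
    and X :: "'w \<Rightarrow> 'f::locally_convex_space"
    and \<epsilon> :: "'w \<Rightarrow> 'g::locally_convex_space"
    and L :: "'f \<Rightarrow> 'g"
    and \<nu> :: "'g measure"
    and \<rho> :: "'f \<Rightarrow> 'g \<Rightarrow> real"
    and F\<^sub>0 :: "'f set" and A :: "'g set"
  assumes souslin_F: "Souslin_space (euclidean :: 'f topology)"
    and souslin_G: "Souslin_space (euclidean :: 'g topology)"
    and P: "prob_space P" "complete_measure P"
    and X: "X \<in> P \<rightarrow>\<^sub>M borel"
    and \<epsilon>: "\<epsilon> \<in> P \<rightarrow>\<^sub>M borel"
    and indep: "indep_rv P borel \<epsilon> borel X"
    and L: "continuous_on UNIV L"
    and \<nu>: "sigma_finite_measure \<nu>" "sets \<nu> = sets borel"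
    and ac: "AE x in distr P borel X.
               absolutely_continuous \<nu> (distr P borel (\<lambda>\<omega>. \<epsilon> \<omega> + L x))"
    and \<rho>_density: "\<And>x. absolutely_continuous \<nu> (distr P borel (\<lambda>\<omega>. \<epsilon> \<omega> + L x)) \<Longrightarrow>
               is_density \<nu> (distr P borel (\<lambda>\<omega>. \<epsilon> \<omega> + L x)) (\<rho> x)"
    and \<rho>_zero: "\<And>x z. \<not> absolutely_continuous \<nu> (distr P borel (\<lambda>\<omega>. \<epsilon> \<omega> + L x)) \<Longrightarrow>
               \<rho> x z = 0"
    and F\<^sub>0: "Souslin_subset F\<^sub>0" "- F\<^sub>0 \<in> null_sets (completion (distr P borel X))"
    and A: "Souslin_subset A" "- A \<in> null_sets (completion \<nu>)"
    and \<rho>_cont: "separately_continuous_on F\<^sub>0 A \<rho>"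
  shows "(\<lambda>(x, z). \<rho> x z) \<in> borel_measurable (completion (distr P borel X \<Otimes>\<^sub>M \<nu>)) \<and>
    ((\<forall>K. compact K \<longrightarrow>
        (\<lambda>x. SUP z\<in>K. ennreal (\<rho> x z)) \<in> borel_measurable (completion (distr P borel X)) \<and>
        (\<integral>\<^sup>+x. (SUP z\<in>K. ennreal (\<rho> x z)) \<partial>completion (distr P borel X)) < \<infinity>) \<longrightarrow>
     (\<forall>K. compact K \<longrightarrow>
        setwise_continuous_on (sets borel)
          (K \<inter> {z\<in>A. 0 < (\<integral>\<^sup>+x. ennreal (\<rho> x z) \<partial>completion (distr P borel X)) \<and>
                      (\<integral>\<^sup>+x. ennreal (\<rho> x z) \<partial>completion (distr P borel X)) < \<infinity>})
          (posterior (distr P borel X) \<rho>)))"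
proof (intro conjI impI allI)
  let ?\<mu> = "distr P borel X"
  interpret P: prob_space P by fact
  interpret \<mu>: prob_space ?\<mu> using X by (rule P.prob_space_distr)
  have sets_\<mu>: "sets ?\<mu> = sets borel" by simp
  have \<rho>: "\<rho> x \<in> borel_measurable (completion \<nu>) \<and> (\<forall>z. 0 \<le> \<rho> x z)" for x
  proof (cases "absolutely_continuous \<nu> (distr P borel (\<lambda>\<omega>. \<epsilon> \<omega> + L x))")
    case True
    then show ?thesis using \<rho>_density unfolding is_density_def by blast
  next
    case False
    then have "\<rho> x = (\<lambda>_. 0)" using \<rho>_zero by blast
    then show ?thesis by simp
  qed
  then have meas: "\<rho> x \<in> borel_measurable (completion \<nu>)" and nonneg: "0 \<le> \<rho> x z" for x z
    by blast+
  have cont_x: "continuous_on F\<^sub>0 (\<lambda>x. \<rho> x z)" if "z \<in> A" for z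
    using \<rho>_cont that unfolding separately_continuous_on_def by blast
  have cont_z: "continuous_on A (\<rho> x)" if "x \<in> F\<^sub>0" for x
    using \<rho>_cont that unfolding separately_continuous_on_def by auto
  show "(\<lambda>(x, z). \<rho> x z) \<in> borel_measurable (completion (?\<mu> \<Otimes>\<^sub>M \<nu>))"
  proof (rule borel_measurable_completion_Caratheodory[OF souslin_F _ sets_\<mu> \<nu>(1) F\<^sub>0])
    show "finite_measure ?\<mu>" by unfold_locales
    show "AE z in \<nu>. continuous_on F\<^sub>0 (\<lambda>x. \<rho> x z)"
      using AE_completion_conull[OF A(2)] by eventually_elim (rule cont_x)
  qed (fact meas)
  fix K :: "'g set"
  assume sup: "\<forall>K. compact K \<longrightarrow>
        (\<lambda>x. SUP z\<in>K. ennreal (\<rho> x z)) \<in> borel_measurable (completion ?\<mu>) \<and>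
        (\<integral>\<^sup>+x. (SUP z\<in>K. ennreal (\<rho> x z)) \<partial>completion ?\<mu>) < \<infinity>"
    and K: "compact K"
  let ?B = "K \<inter> {z\<in>A. 0 < (\<integral>\<^sup>+x. ennreal (\<rho> x z) \<partial>completion ?\<mu>) \<and>
                      (\<integral>\<^sup>+x. ennreal (\<rho> x z) \<partial>completion ?\<mu>) < \<infinity>}"
  \<comment> \<open>Joint measurability would control the sections for almost every \<open>z\<close>
    only. Continuity in \<open>x\<close> on the conull set \<open>F\<^sub>0\<close> gives every
    \<open>z\<close> in \<open>A\<close>.\<close>
  have meas_x: "(\<lambda>x. \<rho> x z) \<in> borel_measurable (completion ?\<mu>)" if "z \<in> A" for z
    using cont_x[OF that] F\<^sub>0(2) sets_\<mu> by (rule continuous_on_conull_borel_measurable_completion)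
  have "AE x in completion ?\<mu>. continuous_on A (\<rho> x)"
    using AE_completion[OF AE_completion_conull[OF F\<^sub>0(2)]] by eventually_elim (rule cont_z)
  then have cont: "continuous_on (K \<inter> A) (\<lambda>z. LINT x|completion ?\<mu>. indicator U x * \<rho> x z)"
    if "U \<in> sets borel" for U
    using sup K that by (intro continuous_on_integral_Souslin_compact[OF souslin_G K nonneg meas_x]) auto
  \<comment> \<open>Both bounds defining the set enter: \<open>enn2real\<close> is positive exactly
    at values that are neither 0 nor infinity.\<close>
  have "(LINT x|completion ?\<mu>. \<rho> x z) \<noteq> 0" if "z \<in> ?B" for z
  proof -
    have "(LINT x|completion ?\<mu>. \<rho> x z) = enn2real (\<integral>\<^sup>+x. ennreal (\<rho> x z) \<partial>completion ?\<mu>)"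
      using that meas_x nonneg by (intro integral_eq_nn_integral) auto
    moreover have "0 < enn2real (\<integral>\<^sup>+x. ennreal (\<rho> x z) \<partial>completion ?\<mu>)"
      using that by (simp add: enn2real_positive_iff)
    ultimately show ?thesis by simp
  qed
  moreover have "continuous_on ?B (\<lambda>z. LINT x|completion ?\<mu>. indicator U x * \<rho> x z)"
    if "U \<in> sets borel" for U
    using cont[OF that] by (rule continuous_on_subset) auto
  \<comment> \<open>The denominator is the numerator for \<open>U = UNIV\<close>.\<close>
  moreover from this[of UNIV] have "continuous_on ?B (\<lambda>z. LINT x|completion ?\<mu>. \<rho> x z)"
    by simp
  ultimately show "setwise_continuous_on (sets borel) ?B (posterior ?\<mu> \<rho>)"
    unfolding setwise_continuous_on_def posterior_def by (intro ballI continuous_on_divide) blast+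
qed

end
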